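(* Let $a,b,c,d$ be positive real numbers with $\min\{c,d\}>\max\{a,b\}$. Then, for all $x\in(0,1)$, $$x\,\Phi(x)\,\overline{\mathcal{W}}(x;a,b;c,d)=\overline{\mathcal{W}}(x;a+1,b+1;d+1,c+2)$$ and $$\frac{\mathrm{d}}{\mathrm{d}x}\Big(x\,\Phi(x)\,\overline{\mathcal{W}}(x;a,b;c,d)\Big)+\Psi(x)\,\overline{\mathcal{W}}(x;a,b;c,d)=0,$$ where $$\Phi(x)=\begin{bmatrix}\dfrac{c(c+1)d}{ab(c-b)} & -\dfrac{(c+1)d}{a(c-b)}\\[2mm] -\dfrac{c(c+1)d(d+1)}{ab(b+1)(d-a)}\,x & \dfrac{(c+1)d(d+1)}{a(b+1)(d-a)}\end{bmatrix}$$ and $$\Psi(x)=\begin{bmatrix}-\dfrac{c(c+1)d}{a(c-b)} & \dfrac{c(c+1)d}{a(c-b)}\\[2mm] \dfrac{c(c+1)d^2(d+1)}{ab(b+1)(d-a)}\,x & -\dfrac{(c+1)d(d+1)}{(b+1)(d-a)}\end{bmatrix}.$$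
   Context: For positive reals $a,b,c,d$ with $\delta:=c+d-a-b>0$, the function $\mathcal{W}(\cdot\,;a,b;c,d)$ on $(0,1)$ is defined by $$\mathcal{W}(x;a,b;c,d)=\frac{\Gamma(c)\Gamma(d)}{\Gamma(a)\Gamma(b)\Gamma(\delta)}\,x^{a-1}(1-x)^{\delta-1}\,{}_2F_1(c-b,d-b;\delta;1-x),$$ where ${}_2F_1(\alpha,\beta;\gamma;z)=\sum_{n\ge0}\frac{(\alpha)_n(\beta)_n}{(\gamma)_n}\frac{z^n}{n!}$ for $|z|<1$, with $(z)_0=1$ and $(z)_n=z(z+1)\cdots(z+n-1)$. (The condition $\min\{c,d\}>\max\{a,b\}$ implies $\delta>0$.) The weight vector is the column vector $$\overline{\mathcal{W}}(x;a,b;c,d)=\begin{bmatrix}\mathcal{W}(x;a,b;c,d)\\ \mathcal{W}(x;a,b+1;c+1,d)\end{bmatrix};$$ thus $\overline{\mathcal{W}}(x;a+1,b+1;d+1,c+2)$ has entries $\mathcal{W}(x;a+1,b+1;d+1,c+2)$ and $\mathcal{W}(x;a+1,b+2;d+2,c+2)$. *)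

theory Defs
  imports "HOL-Analysis.Analysis"
begin

(* Gauss hypergeometric function by its power series; only meaningful for |z| < 1
   (and \<gamma> not a nonpositive integer). *)
definition hyp2F1 :: "real \<Rightarrow> real \<Rightarrow> real \<Rightarrow> real \<Rightarrow> real" where
  "hyp2F1 \<alpha> \<beta> \<gamma> z =
     (\<Sum>n. pochhammer \<alpha> n * pochhammer \<beta> n / pochhammer \<gamma> n * (z ^ n / fact n))"

(* Only meaningful for x \<in> {0<..<1}, a, b, c, d > 0 and c + d - a - b > 0. *)
definition weight :: "real \<Rightarrow> real \<Rightarrow> real \<Rightarrow> real \<Rightarrow> real \<Rightarrow> real" where
  "weight x a b c d =
     (let \<delta> = c + d - a - b in
        Gamma c * Gamma d / (Gamma a * Gamma b * Gamma \<delta>)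
        * x powr (a - 1) * (1 - x) powr (\<delta> - 1) * hyp2F1 (c - b) (d - b) \<delta> (1 - x))"

definition weight_vec :: "real \<Rightarrow> real \<Rightarrow> real \<Rightarrow> real \<Rightarrow> real \<Rightarrow> real ^ 2" where
  "weight_vec x a b c d = vector [weight x a b c d, weight x a (b + 1) (c + 1) d]"

(* The matrices are listed by rows. *)
definition Phi :: "real \<Rightarrow> real \<Rightarrow> real \<Rightarrow> real \<Rightarrow> real \<Rightarrow> real ^ 2 ^ 2" where
  "Phi a b c d x = vector
     [vector [c * (c + 1) * d / (a * b * (c - b)),
              - ((c + 1) * d / (a * (c - b)))],
      vector [- (c * (c + 1) * d * (d + 1) / (a * b * (b + 1) * (d - a))) * x,
              (c + 1) * d * (d + 1) / (a * (b + 1) * (d - a))]]"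

definition Psi :: "real \<Rightarrow> real \<Rightarrow> real \<Rightarrow> real \<Rightarrow> real \<Rightarrow> real ^ 2 ^ 2" where
  "Psi a b c d x = vector
     [vector [- (c * (c + 1) * d / (a * (c - b))),
              c * (c + 1) * d / (a * (c - b))],
      vector [c * (c + 1) * d\<^sup>2 * (d + 1) / (a * b * (b + 1) * (d - a)) * x,
              - ((c + 1) * d * (d + 1) / ((b + 1) * (d - a)))]]"

end

(* In the variable z = 1 - x each weight is x^(p-1) z^(q-1) times a Gauss series in z.
   Comparing coefficients, the first identity amounts to two contiguity relations expressing
   2F1(alpha + 1, beta; gamma + 1) and 2F1(alpha, beta; gamma + 1) through 2F1(alpha, beta; gamma)
   and 2F1(alpha, beta - 1; gamma), where alpha = c - b, beta = d - b, gamma = c + d - a - b.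
   For the derivative, d/dz (z^gamma 2F1(.,.; gamma + 1)) = gamma z^(gamma - 1) 2F1(.,.; gamma);
   one further contiguity relation brings the result back to the same two series. *)
theory Submission
  imports Defs "HOL-Real_Asymp.Real_Asymp"
begin

section \<open>Coefficients and convergence of the Gauss series\<close>

definition hyp2F1_coeff :: "real \<Rightarrow> real \<Rightarrow> real \<Rightarrow> nat \<Rightarrow> real" where
  "hyp2F1_coeff \<alpha> \<beta> \<gamma> n = pochhammer \<alpha> n * pochhammer \<beta> n / (pochhammer \<gamma> n * fact n)"

lemma hyp2F1_coeff_0 [simp]: "hyp2F1_coeff \<alpha> \<beta> \<gamma> 0 = 1"
  by (simp add: hyp2F1_coeff_def)

text \<open>By the convention \<open>x / 0 = 0\<close> both sides vanish as soon as a factor of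
  \<open>pochhammer \<gamma> (Suc n)\<close> is zero, so the recursion holds for every real
  \<open>\<gamma>\<close>.\<close>

lemma hyp2F1_coeff_Suc:
  "hyp2F1_coeff \<alpha> \<beta> \<gamma> (Suc n) =
     (\<alpha> + n) * (\<beta> + n) / ((\<gamma> + n) * (n + 1)) * hyp2F1_coeff \<alpha> \<beta> \<gamma> n"
  unfolding hyp2F1_coeff_def pochhammer_Suc fact_Suc times_divide_times_eq
  by (simp add: mult_ac add_ac)

lemma hyp2F1_eq_suminf: "hyp2F1 \<alpha> \<beta> \<gamma> z = (\<Sum>n. hyp2F1_coeff \<alpha> \<beta> \<gamma> n * z ^ n)"
  by (simp add: hyp2F1_def hyp2F1_coeff_def)

lemma hyp2F1_commute: "hyp2F1 \<alpha> \<beta> \<gamma> z = hyp2F1 \<beta> \<alpha> \<gamma> z"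
  by (simp add: hyp2F1_def mult.commute)

text \<open>Ratio test: the factor \<open>?q n\<close> between consecutive terms tends to
  \<open>z\<close>, so its absolute value eventually stays below a fixed \<open>r\<close> with
  \<open>\<bar>z\<bar> < r < 1\<close>.\<close>

lemma summable_hyp2F1:
  assumes "\<bar>z\<bar> < 1"
  shows "summable (\<lambda>n. hyp2F1_coeff \<alpha> \<beta> \<gamma> n * z ^ n)"
proof -
  let ?q = "\<lambda>n::nat. (\<alpha> + n) * (\<beta> + n) / ((\<gamma> + n) * (n + 1)) * z"
  obtain r where r: "\<bar>z\<bar> < r" "r < 1" using assms dense by blast
  have "?q \<longlonglongrightarrow> 1 * z"
    by (rule tendsto_mult_right) real_asymp
  hence "(\<lambda>n. \<bar>?q n\<bar>) \<longlonglongrightarrow> \<bar>z\<bar>"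
    using tendsto_rabs by fastforce
  hence "\<forall>\<^sub>F n in sequentially. \<bar>?q n\<bar> < r"
    using r(1) by (rule order_tendstoD)
  then obtain N where N: "\<forall>n\<ge>N. \<bar>?q n\<bar> < r"
    unfolding eventually_sequentially by (rule exE) simp
  show ?thesis
  proof (rule summable_ratio_test[OF r(2)])
    fix n :: nat assume n: "n \<ge> N"
    have "norm (hyp2F1_coeff \<alpha> \<beta> \<gamma> (Suc n) * z ^ Suc n) =
        \<bar>?q n\<bar> * norm (hyp2F1_coeff \<alpha> \<beta> \<gamma> n * z ^ n)"
      by (simp add: hyp2F1_coeff_Suc abs_mult mult_ac add_ac)
    also have "\<dots> \<le> r * norm (hyp2F1_coeff \<alpha> \<beta> \<gamma> n * z ^ n)"
      by (rule mult_right_mono[OF less_imp_le[OF N[rule_format, OF n]] norm_ge_zero])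
    finally show "norm (hyp2F1_coeff \<alpha> \<beta> \<gamma> (Suc n) * z ^ Suc n)
        \<le> r * norm (hyp2F1_coeff \<alpha> \<beta> \<gamma> n * z ^ n)" .
  qed
qed

lemma hyp2F1_sums:
  "\<bar>z\<bar> < 1 \<Longrightarrow> (\<lambda>n. hyp2F1_coeff \<alpha> \<beta> \<gamma> n * z ^ n) sums hyp2F1 \<alpha> \<beta> \<gamma> z"
  unfolding hyp2F1_eq_suminf by (intro summable_sums summable_hyp2F1)

text \<open>Multiplication by \<open>z\<close> moves the coefficients up by one index and leaves 0
  at index 0. In this form, contiguity relations containing a factor \<open>z\<close> can be checked
  term by term.\<close>

lemma hyp2F1_sums_shift:
  assumes "\<bar>z\<bar> < 1"
  shows "(\<lambda>n. (case n of 0 \<Rightarrow> 0 | Suc m \<Rightarrow> hyp2F1_coeff \<alpha> \<beta> \<gamma> m) * z ^ n)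
           sums (z * hyp2F1 \<alpha> \<beta> \<gamma> z)"
proof -
  let ?f = "\<lambda>n. (case n of 0 \<Rightarrow> 0 | Suc m \<Rightarrow> hyp2F1_coeff \<alpha> \<beta> \<gamma> m) * z ^ n"
  have "(\<lambda>n. ?f (Suc n)) sums (z * hyp2F1 \<alpha> \<beta> \<gamma> z)"
    using sums_mult[OF hyp2F1_sums[OF assms], of z \<alpha> \<beta> \<gamma>] by (simp add: mult_ac)
  from sums_Suc[OF this] show ?thesis by simp
qed

section \<open>Contiguity relations, first between coefficients and then between sums\<close>

lemma notin_nonpos_Ints_neq_0: "(\<gamma>::real) \<notin> \<int>\<^sub>\<le>\<^sub>0 \<Longrightarrow> \<gamma> \<noteq> 0"
  by auto

lemma notin_nonpos_Ints_shift_neq_0: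
  fixes \<gamma> :: real
  assumes "\<gamma> \<notin> \<int>\<^sub>\<le>\<^sub>0"
  shows "\<gamma> + of_nat n \<noteq> 0" "pochhammer \<gamma> n \<noteq> 0" "pochhammer (\<gamma> + 1) n \<noteq> 0"
proof -
  have *: "\<gamma> + of_nat n \<noteq> 0" for n
    using assms by (metis add_eq_0_iff2 minus_of_nat_in_nonpos_Ints)
  show "\<gamma> + of_nat n \<noteq> 0" by (rule *)
  show "pochhammer \<gamma> n \<noteq> 0"
    using * by (auto simp: pochhammer_eq_0_iff eq_neg_iff_add_eq_0)
  have "\<gamma> + 1 + of_nat n \<noteq> 0" for n
    using *[of "Suc n"] by (simp add: add_ac)
  thus "pochhammer (\<gamma> + 1) n \<noteq> 0"
    by (auto simp: pochhammer_eq_0_iff eq_neg_iff_add_eq_0)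
qed

text \<open>Splitting off the first factors of the Pochhammer symbols of \<open>\<alpha>\<close>,
  \<open>\<gamma>\<close> and \<open>\<beta> - 1\<close>, and the last factor of that of
  \<open>\<beta>\<close>, makes both coefficients multiples of the same \<open>?X\<close>. The two
  multipliers differ by exactly 1.\<close>

lemma hyp2F1_coeff_Suc_diff:
  assumes "\<gamma> \<notin> \<int>\<^sub>\<le>\<^sub>0"
  shows "hyp2F1_coeff \<alpha> \<beta> \<gamma> (Suc n) - hyp2F1_coeff \<alpha> (\<beta> - 1) \<gamma> (Suc n)
           = \<alpha> / \<gamma> * hyp2F1_coeff (\<alpha> + 1) \<beta> (\<gamma> + 1) n"
proof -
  let ?X = "\<alpha> / \<gamma> * hyp2F1_coeff (\<alpha> + 1) \<beta> (\<gamma> + 1) n"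
  have "hyp2F1_coeff \<alpha> \<beta> \<gamma> (Suc n) = (\<beta> + n) / (n + 1) * ?X"
    unfolding hyp2F1_coeff_def pochhammer_rec[of \<alpha>] pochhammer_rec[of \<gamma>] pochhammer_Suc[of \<beta>]
      fact_Suc times_divide_times_eq by (simp add: mult_ac add_ac)
  moreover have "hyp2F1_coeff \<alpha> (\<beta> - 1) \<gamma> (Suc n) = (\<beta> - 1) / (n + 1) * ?X"
    unfolding hyp2F1_coeff_def pochhammer_rec[of \<alpha>] pochhammer_rec[of \<gamma>]
      pochhammer_rec[of "\<beta> - 1"] fact_Suc times_divide_times_eq by (simp add: mult_ac add_ac)
  moreover have "(\<beta> + n) / (n + 1) - (\<beta> - 1) / (n + 1) = (1::real)"
    by (simp add: diff_divide_distrib[symmetric])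
  ultimately show ?thesis by (metis left_diff_distrib mult_1)
qed

text \<open>The Pochhammer symbol of order \<open>n + 1\<close> can be split at its first or at its
  last factor. In terms of series, the operator \<open>\<gamma> + z d/dz\<close> lowers the
  parameter \<open>\<gamma> + 1\<close> to \<open>\<gamma>\<close>; in the same way
  \<open>\<alpha> + z d/dz\<close> raises \<open>\<alpha>\<close> in the next lemma.\<close>

lemma hyp2F1_coeff_raise_lower_param:
  assumes "\<gamma> \<notin> \<int>\<^sub>\<le>\<^sub>0"
  shows "(\<gamma> + n) * hyp2F1_coeff \<alpha> \<beta> (\<gamma> + 1) n = \<gamma> * hyp2F1_coeff \<alpha> \<beta> \<gamma> n"
proof -
  note nz = notin_nonpos_Ints_neq_0[OF assms] notin_nonpos_Ints_shift_neq_0[OF assms, of n]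
  have "\<gamma> * pochhammer (\<gamma> + 1) n = pochhammer \<gamma> n * (\<gamma> + n)"
    using pochhammer_rec[of \<gamma> n] pochhammer_Suc[of \<gamma> n] by simp
  thus ?thesis using nz unfolding hyp2F1_coeff_def by (simp add: divide_simps)
qed

lemma hyp2F1_coeff_raise_upper_param:
  "\<alpha> * hyp2F1_coeff (\<alpha> + 1) \<beta> \<gamma> n = (\<alpha> + n) * hyp2F1_coeff \<alpha> \<beta> \<gamma> n"
proof -
  have "\<alpha> * pochhammer (\<alpha> + 1) n = pochhammer \<alpha> n * (\<alpha> + n)"
    using pochhammer_rec[of \<alpha> n] pochhammer_Suc[of \<alpha> n] by simp
  thus ?thesis unfolding hyp2F1_coeff_def by (simp add: divide_simps)
qed

text \<open>The constant terms cancel, so the difference starts at order one, which produces the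
  factor \<open>z\<close>; the higher coefficients are compared by
  \<open>hyp2F1_coeff_Suc_diff\<close>.\<close>

lemma hyp2F1_diff_upper_param:
  assumes "\<gamma> \<notin> \<int>\<^sub>\<le>\<^sub>0" "\<bar>z\<bar> < 1"
  shows "hyp2F1 \<alpha> \<beta> \<gamma> z - hyp2F1 \<alpha> (\<beta> - 1) \<gamma> z = \<alpha> / \<gamma> * (z * hyp2F1 (\<alpha> + 1) \<beta> (\<gamma> + 1) z)"
proof (rule sums_unique2)
  show "(\<lambda>n. hyp2F1_coeff \<alpha> \<beta> \<gamma> n * z ^ n - hyp2F1_coeff \<alpha> (\<beta> - 1) \<gamma> n * z ^ n)
      sums (hyp2F1 \<alpha> \<beta> \<gamma> z - hyp2F1 \<alpha> (\<beta> - 1) \<gamma> z)"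
    by (intro sums_diff hyp2F1_sums assms)
  have eq: "hyp2F1_coeff \<alpha> \<beta> \<gamma> n * z ^ n - hyp2F1_coeff \<alpha> (\<beta> - 1) \<gamma> n * z ^ n
      = \<alpha> / \<gamma> * ((case n of 0 \<Rightarrow> 0 | Suc m \<Rightarrow> hyp2F1_coeff (\<alpha> + 1) \<beta> (\<gamma> + 1) m) * z ^ n)" for n
  proof (cases n)
    case (Suc m)
    show ?thesis
      unfolding Suc left_diff_distrib[symmetric] hyp2F1_coeff_Suc_diff[OF assms(1)] by simp
  qed simp
  show "(\<lambda>n. hyp2F1_coeff \<alpha> \<beta> \<gamma> n * z ^ n - hyp2F1_coeff \<alpha> (\<beta> - 1) \<gamma> n * z ^ n)
      sums (\<alpha> / \<gamma> * (z * hyp2F1 (\<alpha> + 1) \<beta> (\<gamma> + 1) z))"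
    unfolding eq by (intro sums_mult hyp2F1_sums_shift assms)
qed

text \<open>With \<open>h\<close> the coefficient for
  \<open>\<alpha>, \<beta>, \<gamma> + 1\<close>, the two parameter shifts give
  \<open>(\<gamma> + n) * h\<close> and \<open>(\<alpha> + n) * h\<close>. Their difference is
  \<open>(\<gamma> - \<alpha>) * h\<close>, free of \<open>n\<close>, hence a relation between the
  sums.\<close>

lemma hyp2F1_raise_lower_param:
  assumes "\<gamma> \<notin> \<int>\<^sub>\<le>\<^sub>0" "\<bar>z\<bar> < 1"
  shows "hyp2F1 \<alpha> (\<beta> - 1) \<gamma> z - (1 - z) * hyp2F1 \<alpha> \<beta> \<gamma> z
           = (\<gamma> - \<alpha>) / \<gamma> * (z * hyp2F1 \<alpha> \<beta> (\<gamma> + 1) z)"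
proof -
  have coeff: "hyp2F1_coeff \<alpha> \<beta> \<gamma> n - \<alpha> / \<gamma> * hyp2F1_coeff (\<alpha> + 1) \<beta> (\<gamma> + 1) n
      = (\<gamma> - \<alpha>) / \<gamma> * hyp2F1_coeff \<alpha> \<beta> (\<gamma> + 1) n" for n
  proof -
    let ?f = "hyp2F1_coeff \<alpha> \<beta> \<gamma> n" and ?g = "hyp2F1_coeff (\<alpha> + 1) \<beta> (\<gamma> + 1) n"
    have "?f - \<alpha> / \<gamma> * ?g = (\<gamma> * ?f - \<alpha> * ?g) / \<gamma>"
      using notin_nonpos_Ints_neq_0[OF assms(1)] by (simp add: diff_divide_distrib)
    also have "\<gamma> * ?f - \<alpha> * ?g = (\<gamma> - \<alpha>) * hyp2F1_coeff \<alpha> \<beta> (\<gamma> + 1) n"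
      using hyp2F1_coeff_raise_upper_param[of \<alpha> \<beta> "\<gamma> + 1" n]
        hyp2F1_coeff_raise_lower_param[OF assms(1), of n \<alpha> \<beta>] by algebra
    finally show ?thesis by simp
  qed
  have "hyp2F1 \<alpha> \<beta> \<gamma> z - \<alpha> / \<gamma> * hyp2F1 (\<alpha> + 1) \<beta> (\<gamma> + 1) z
      = (\<gamma> - \<alpha>) / \<gamma> * hyp2F1 \<alpha> \<beta> (\<gamma> + 1) z"
  proof (rule sums_unique2)
    show "(\<lambda>n. hyp2F1_coeff \<alpha> \<beta> \<gamma> n * z ^ n
          - \<alpha> / \<gamma> * (hyp2F1_coeff (\<alpha> + 1) \<beta> (\<gamma> + 1) n * z ^ n))
        sums (hyp2F1 \<alpha> \<beta> \<gamma> z - \<alpha> / \<gamma> * hyp2F1 (\<alpha> + 1) \<beta> (\<gamma> + 1) z)"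
      by (intro sums_diff sums_mult hyp2F1_sums assms)
    show "(\<lambda>n. hyp2F1_coeff \<alpha> \<beta> \<gamma> n * z ^ n
          - \<alpha> / \<gamma> * (hyp2F1_coeff (\<alpha> + 1) \<beta> (\<gamma> + 1) n * z ^ n))
        sums ((\<gamma> - \<alpha>) / \<gamma> * hyp2F1 \<alpha> \<beta> (\<gamma> + 1) z)"
      unfolding mult.assoc[symmetric] left_diff_distrib[symmetric] coeff
      unfolding mult.assoc by (intro sums_mult hyp2F1_sums assms)
  qed
  \<comment> \<open>Multiply the relation by \<open>z\<close> and eliminate the series with
    parameters \<open>\<alpha> + 1, \<beta>, \<gamma> + 1\<close> through the previous contiguity
    relation.\<close>
  with hyp2F1_diff_upper_param[OF assms, of \<alpha> \<beta>] show ?thesis by algebra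
qed

text \<open>Serves to eliminate the series with \<open>\<alpha> + 1, \<beta>, \<gamma>\<close>,
  which appears when the first target weight is differentiated. All coefficients involved are
  multiples of \<open>?g n\<close>, so the relation reduces to a polynomial identity in
  \<open>n\<close>; the factor \<open>1 - z\<close> contributes a shifted copy of the
  series.\<close>

lemma hyp2F1_lower_both_upper_params:
  assumes "\<gamma> \<notin> \<int>\<^sub>\<le>\<^sub>0" "\<bar>z\<bar> < 1"
  shows "\<gamma> * hyp2F1 \<alpha> (\<beta> - 1) \<gamma> z = \<gamma> * (1 - z) * hyp2F1 (\<alpha> + 1) \<beta> \<gamma> z
           - (\<alpha> + \<beta> - \<gamma>) * (z * hyp2F1 (\<alpha> + 1) \<beta> (\<gamma> + 1) z)"
proof -
  let ?g = "hyp2F1_coeff (\<alpha> + 1) \<beta> (\<gamma> + 1)"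
  have coeff: "\<gamma> * hyp2F1_coeff \<alpha> (\<beta> - 1) \<gamma> (Suc n)
      = \<gamma> * hyp2F1_coeff (\<alpha> + 1) \<beta> \<gamma> (Suc n) - \<gamma> * hyp2F1_coeff (\<alpha> + 1) \<beta> \<gamma> n
        - (\<alpha> + \<beta> - \<gamma>) * ?g n" for n
  proof -
    have nz: "\<gamma> \<noteq> 0" by (rule notin_nonpos_Ints_neq_0[OF assms(1)])
    have n1: "real n + 1 \<noteq> 0" "\<gamma> + 1 + n \<noteq> 0"
      using notin_nonpos_Ints_shift_neq_0(1)[OF assms(1), of "Suc n"] by (auto simp: algebra_simps)
    have "\<gamma> * hyp2F1_coeff \<alpha> (\<beta> - 1) \<gamma> (Suc n) = \<alpha> * (\<beta> - 1) / (n + 1) * ?g n"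
      unfolding hyp2F1_coeff_def pochhammer_rec[of \<alpha>] pochhammer_rec[of \<gamma>]
        pochhammer_rec[of "\<beta> - 1"] using nz by (simp add: mult_ac)
    moreover have "\<gamma> * hyp2F1_coeff (\<alpha> + 1) \<beta> \<gamma> (Suc n) = (\<alpha> + 1 + n) * (\<beta> + n) / (n + 1) * ?g n"
    proof -
      \<comment> \<open>Lowering \<open>\<gamma> + 1\<close> at index \<open>Suc n\<close> brings
        the factor \<open>\<gamma> + 1 + n\<close>, which cancels the denominator of the recursion
        from \<open>n\<close> to \<open>Suc n\<close>.\<close>
      have "\<gamma> + real (Suc n) = \<gamma> + 1 + n" by simp
      thus ?thesis
        unfolding hyp2F1_coeff_raise_lower_param[OF assms(1), symmetric]
          hyp2F1_coeff_Suc[of _ _ "\<gamma> + 1"] using n1 by (simp add: add.assoc)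
    qed
    moreover have "\<gamma> * hyp2F1_coeff (\<alpha> + 1) \<beta> \<gamma> n = (\<gamma> + n) * ?g n"
      by (simp add: hyp2F1_coeff_raise_lower_param[OF assms(1)])
    moreover have "\<alpha> * (\<beta> - 1) / (n + 1)
        = (\<alpha> + 1 + n) * (\<beta> + n) / (n + 1) - (\<gamma> + n) - (\<alpha> + \<beta> - \<gamma>)"
    proof -
      have "\<alpha> * (\<beta> - 1) = (\<alpha> + 1 + n) * (\<beta> + n) - (n + 1) * ((\<gamma> + n) + (\<alpha> + \<beta> - \<gamma>))"
        by (simp add: algebra_simps)
      thus ?thesis using n1(1) by (simp add: diff_divide_distrib)
    qed
    ultimately show ?thesis by (simp only: left_diff_distrib)
  qed
  have eq: "\<gamma> * (hyp2F1_coeff \<alpha> (\<beta> - 1) \<gamma> n * z ^ n)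
      = \<gamma> * (hyp2F1_coeff (\<alpha> + 1) \<beta> \<gamma> n * z ^ n)
        - \<gamma> * ((case n of 0 \<Rightarrow> 0 | Suc m \<Rightarrow> hyp2F1_coeff (\<alpha> + 1) \<beta> \<gamma> m) * z ^ n)
        - (\<alpha> + \<beta> - \<gamma>) * ((case n of 0 \<Rightarrow> 0 | Suc m \<Rightarrow> ?g m) * z ^ n)" for n
  proof (cases n)
    case (Suc m)
    show ?thesis
      unfolding Suc mult.assoc[symmetric] coeff by (simp add: left_diff_distrib)
  qed simp
  have "\<gamma> * hyp2F1 \<alpha> (\<beta> - 1) \<gamma> z = \<gamma> * hyp2F1 (\<alpha> + 1) \<beta> \<gamma> z
      - \<gamma> * (z * hyp2F1 (\<alpha> + 1) \<beta> \<gamma> z)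
      - (\<alpha> + \<beta> - \<gamma>) * (z * hyp2F1 (\<alpha> + 1) \<beta> (\<gamma> + 1) z)"
  proof (rule sums_unique2)
    show "(\<lambda>n. \<gamma> * (hyp2F1_coeff \<alpha> (\<beta> - 1) \<gamma> n * z ^ n)) sums (\<gamma> * hyp2F1 \<alpha> (\<beta> - 1) \<gamma> z)"
      by (intro sums_mult hyp2F1_sums assms)
    show "(\<lambda>n. \<gamma> * (hyp2F1_coeff \<alpha> (\<beta> - 1) \<gamma> n * z ^ n)) sums (\<gamma> * hyp2F1 (\<alpha> + 1) \<beta> \<gamma> z
      - \<gamma> * (z * hyp2F1 (\<alpha> + 1) \<beta> \<gamma> z)
      - (\<alpha> + \<beta> - \<gamma>) * (z * hyp2F1 (\<alpha> + 1) \<beta> (\<gamma> + 1) z))"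
      unfolding eq by (intro sums_diff sums_mult hyp2F1_sums hyp2F1_sums_shift assms)
  qed
  thus ?thesis by (simp add: algebra_simps)
qed

section \<open>Derivatives of a power times a Gauss series\<close>

lemma has_real_derivative_powr_mult_hyp2F1:
  assumes "\<gamma> \<notin> \<int>\<^sub>\<le>\<^sub>0" "0 < z" "z < 1"
  shows "((\<lambda>z. z powr \<gamma> * hyp2F1 \<alpha> \<beta> (\<gamma> + 1) z) has_real_derivative
           \<gamma> * z powr (\<gamma> - 1) * hyp2F1 \<alpha> \<beta> \<gamma> z) (at z)"
proof -
  let ?h = "hyp2F1_coeff \<alpha> \<beta> (\<gamma> + 1)"
  let ?D = "\<Sum>n. diffs ?h n * z ^ n"
  have z: "\<bar>z\<bar> < 1" using assms by simp
  have der: "(hyp2F1 \<alpha> \<beta> (\<gamma> + 1) has_real_derivative ?D) (at z)"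
    unfolding hyp2F1_eq_suminf[abs_def]
    by (rule termdiffs_strong'[where K = 1]) (use z summable_hyp2F1 in auto)
  have "summable (\<lambda>n. diffs ?h n * z ^ n)"
    by (rule termdiff_converges[where K = 1]) (use z summable_hyp2F1 in auto)
  hence "(\<lambda>n. n * ?h n * z ^ (n - Suc 0)) sums ?D"
    by (rule diffs_equiv)
  hence *: "(\<lambda>n. \<gamma> * (?h n * z ^ n) + z * (n * ?h n * z ^ (n - Suc 0)))
      sums (\<gamma> * hyp2F1 \<alpha> \<beta> (\<gamma> + 1) z + z * ?D)"
    by (intro sums_add sums_mult hyp2F1_sums z)
  \<comment> \<open>Termwise form of \<open>\<gamma> + z d/dz\<close>, which turns the series for
    \<open>\<gamma> + 1\<close> into \<open>\<gamma>\<close> times the series for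
    \<open>\<gamma>\<close>. At \<open>n = 0\<close> the exponent \<open>n - Suc 0\<close> is
    truncated to 0, but the factor \<open>n\<close> kills that term.\<close>
  have "\<gamma> * (?h n * z ^ n) + z * (n * ?h n * z ^ (n - Suc 0)) = (\<gamma> + n) * ?h n * z ^ n" for n
    by (cases n) (simp_all add: algebra_simps)
  hence "\<gamma> * (?h n * z ^ n) + z * (n * ?h n * z ^ (n - Suc 0))
      = \<gamma> * (hyp2F1_coeff \<alpha> \<beta> \<gamma> n * z ^ n)" for n
    by (simp add: hyp2F1_coeff_raise_lower_param[OF assms(1)])
  with * have "(\<lambda>n. \<gamma> * (hyp2F1_coeff \<alpha> \<beta> \<gamma> n * z ^ n))
      sums (\<gamma> * hyp2F1 \<alpha> \<beta> (\<gamma> + 1) z + z * ?D)" by simp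
  moreover have "(\<lambda>n. \<gamma> * (hyp2F1_coeff \<alpha> \<beta> \<gamma> n * z ^ n)) sums (\<gamma> * hyp2F1 \<alpha> \<beta> \<gamma> z)"
    by (intro sums_mult hyp2F1_sums z)
  ultimately have D: "\<gamma> * hyp2F1 \<alpha> \<beta> (\<gamma> + 1) z + z * ?D = \<gamma> * hyp2F1 \<alpha> \<beta> \<gamma> z"
    by (rule sums_unique2)
  have powr: "z powr \<gamma> = z * z powr (\<gamma> - 1)"
    using assms by (simp add: powr_diff)
  have "((\<lambda>z. z powr \<gamma> * hyp2F1 \<alpha> \<beta> (\<gamma> + 1) z) has_real_derivative
      z powr \<gamma> * ?D + (\<gamma> * z powr (\<gamma> - 1)) * hyp2F1 \<alpha> \<beta> (\<gamma> + 1) z) (at z)"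
    by (intro DERIV_mult' der has_real_derivative_powr assms)
  also have "z powr \<gamma> * ?D + (\<gamma> * z powr (\<gamma> - 1)) * hyp2F1 \<alpha> \<beta> (\<gamma> + 1) z
      = z powr (\<gamma> - 1) * (\<gamma> * hyp2F1 \<alpha> \<beta> (\<gamma> + 1) z + z * ?D)"
    unfolding powr by (simp add: algebra_simps)
  finally show ?thesis unfolding D by (simp add: mult_ac)
qed

text \<open>Product rule, with the minus sign coming from the inner function \<open>1 - x\<close>.
  The powers taken out are those of the original weights, so that afterwards only the bracket has to
  be compared with their series.\<close>

lemma has_real_derivative_weight_kernel:
  assumes "\<gamma> \<notin> \<int>\<^sub>\<le>\<^sub>0" "0 < x" "x < 1"
  shows "((\<lambda>x. x powr a * ((1 - x) powr \<gamma> * hyp2F1 \<alpha> \<beta> (\<gamma> + 1) (1 - x))) has_real_derivative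
           x powr (a - 1) * (1 - x) powr (\<gamma> - 1) *
             (a * ((1 - x) * hyp2F1 \<alpha> \<beta> (\<gamma> + 1) (1 - x)) - \<gamma> * x * hyp2F1 \<alpha> \<beta> \<gamma> (1 - x))) (at x)"
proof -
  let ?D = "\<gamma> * (1 - x) powr (\<gamma> - 1) * hyp2F1 \<alpha> \<beta> \<gamma> (1 - x)"
  have "((\<lambda>x. 1 - x) has_real_derivative - 1) (at x)"
    by (auto intro!: derivative_eq_intros)
  moreover have "((\<lambda>z. z powr \<gamma> * hyp2F1 \<alpha> \<beta> (\<gamma> + 1) z) has_real_derivative ?D) (at (1 - x))"
    by (rule has_real_derivative_powr_mult_hyp2F1) (use assms in simp_all)
  ultimately have "((\<lambda>x. (1 - x) powr \<gamma> * hyp2F1 \<alpha> \<beta> (\<gamma> + 1) (1 - x))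
      has_real_derivative ?D * (- 1)) (at x)"
    by (rule DERIV_chain2[rotated])
  note der = DERIV_mult'[OF has_real_derivative_powr[OF assms(2), of a] this]
  have powr: "x powr a = x * x powr (a - 1)" "(1 - x) powr \<gamma> = (1 - x) * (1 - x) powr (\<gamma> - 1)"
    using assms by (simp_all add: powr_diff)
  show ?thesis
    by (rule DERIV_cong[OF der], unfold powr) (simp add: algebra_simps)
qed

section \<open>From scalar identities for the weights to the vector equations\<close>

lemma vector_2_eq_axis: "(vector [u, v] :: real ^ 2) = u *\<^sub>R axis 1 1 + v *\<^sub>R axis 2 1"
  by (simp add: vec_eq_iff forall_2 axis_def)

text \<open>Expansion along the two axis vectors reduces this to scalar functions times constant
  vectors.\<close>

lemma has_vector_derivative_vector_2:
  assumes f: "(f has_real_derivative f') (at x within S)"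
    and g: "(g has_real_derivative g') (at x within S)"
  shows "((\<lambda>t. vector [f t, g t] :: real ^ 2) has_vector_derivative vector [f', g']) (at x within S)"
  using has_vector_derivative_add[OF
      has_vector_derivative_scaleR[OF f has_vector_derivative_const[of "axis 1 1 :: real ^ 2"]]
      has_vector_derivative_scaleR[OF g has_vector_derivative_const[of "axis 2 1 :: real ^ 2"]]]
  unfolding vector_2_eq_axis by simp

text \<open>The matrix equations by rows: the first two claims are the rows of the
  \<open>Phi\<close> identity, the last two give the rows of minus \<open>Psi\<close> times the
  weight vector. The derivatives are taken of the target weights, because each of these is a
  constant times a single kernel.\<close>

lemma weight_system:
  fixes a b c d :: real
  assumes pos: "a > 0" "b > 0" "c > 0" "d > 0"
    and cd: "c > a" "c > b" "d > a" "d > b"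
    and x: "0 < x" "x < 1"
  shows "x * (c * (c + 1) * d / (a * b * (c - b)) * weight x a b c d
           - (c + 1) * d / (a * (c - b)) * weight x a (b + 1) (c + 1) d)
         = weight x (a + 1) (b + 1) (d + 1) (c + 2)" (is ?A)
    and "x * ((c + 1) * d * (d + 1) / (a * (b + 1) * (d - a)) * weight x a (b + 1) (c + 1) d
           - c * (c + 1) * d * (d + 1) / (a * b * (b + 1) * (d - a)) * x * weight x a b c d)
         = weight x (a + 1) (b + 2) (d + 2) (c + 2)" (is ?B)
    and "((\<lambda>x. weight x (a + 1) (b + 1) (d + 1) (c + 2)) has_real_derivative
           c * (c + 1) * d / (a * (c - b)) * weight x a b c d
           - c * (c + 1) * d / (a * (c - b)) * weight x a (b + 1) (c + 1) d) (at x)" (is ?C)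
    and "((\<lambda>x. weight x (a + 1) (b + 2) (d + 2) (c + 2)) has_real_derivative
           (c + 1) * d * (d + 1) / ((b + 1) * (d - a)) * weight x a (b + 1) (c + 1) d
           - c * (c + 1) * d\<^sup>2 * (d + 1) / (a * b * (b + 1) * (d - a)) * x * weight x a b c d) (at x)"
      (is ?D)
proof -
  define \<alpha> \<beta> \<gamma> \<epsilon>
    where "\<alpha> = c - b" and "\<beta> = d - b" and "\<gamma> = c + d - a - b" and "\<epsilon> = d - a"
  define K where "K = Gamma c * Gamma d / (Gamma a * Gamma b * Gamma \<gamma>)"
  \<comment> \<open>\<open>F\<close> and \<open>F'\<close> are the series of the two original
    weights, which share \<open>\<gamma>\<close>; \<open>G\<close> and \<open>H\<close> belong to
    the target weights, and \<open>E\<close> arises from differentiating the kernel of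
    \<open>G\<close>. Everything is reduced to \<open>F\<close> and \<open>F'\<close>.\<close>
  define F where "F = hyp2F1 \<alpha> \<beta> \<gamma> (1 - x)"
  define F' where "F' = hyp2F1 \<alpha> (\<beta> - 1) \<gamma> (1 - x)"
  define G where "G = hyp2F1 (\<alpha> + 1) \<beta> (\<gamma> + 1) (1 - x)"
  define H where "H = hyp2F1 \<alpha> \<beta> (\<gamma> + 1) (1 - x)"
  define E where "E = hyp2F1 (\<alpha> + 1) \<beta> \<gamma> (1 - x)"
  define P where "P = x powr (a - 1) * (1 - x) powr (\<gamma> - 1)"
  have gt: "\<alpha> > 0" "\<gamma> > 0" "\<epsilon> > 0" using cd by (auto simp: \<alpha>_def \<gamma>_def \<epsilon>_def)
  have sub: "c - b = \<alpha>" "d - a = \<epsilon>" by (simp_all add: \<alpha>_def \<epsilon>_def)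
  have \<epsilon>: "\<gamma> - \<alpha> = \<epsilon>" by (simp add: \<alpha>_def \<gamma>_def \<epsilon>_def)
  have \<gamma>: "\<gamma> \<notin> \<int>\<^sub>\<le>\<^sub>0" using gt(2) nonpos_Ints_nonpos by fastforce
  have z: "\<bar>1 - x\<bar> < 1" using x by simp
  have Gam: "Gamma (y + 1) = y * Gamma y" "Gamma (y + 2) = (y + 1) * (y * Gamma y)"
    if "y > 0" for y :: real
    using that Gamma_plus1[of y] Gamma_plus1[of "y + 1"]
    by (auto simp: add.assoc nonpos_Ints_def)
  have W1: "weight x a b c d = K * P * F"
    by (simp add: weight_def Let_def K_def F_def P_def \<alpha>_def \<beta>_def \<gamma>_def)
  have W2: "weight x a (b + 1) (c + 1) d = K * (c / b) * P * F'"
  proof -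
    have e: "c + 1 + d - a - (b + 1) = \<gamma>" "c + 1 - (b + 1) = \<alpha>" "d - (b + 1) = \<beta> - 1"
      by (simp_all add: \<alpha>_def \<beta>_def \<gamma>_def)
    show ?thesis unfolding weight_def Let_def e Gam[OF pos(2)] Gam[OF pos(3)]
      by (simp add: K_def F'_def P_def mult_ac)
  qed
  \<comment> \<open>These constants collect the factors that
    \<open>Gamma (y + 1) = y * Gamma y\<close> produces when the shifted Gamma quotients are brought
    back to \<open>K\<close>.\<close>
  let ?K3 = "K * (c * (c + 1) * d / (a * b * \<gamma>))"
  let ?K4 = "K * (c * (c + 1) * d * (d + 1) / (a * b * (b + 1) * \<gamma>))"
  \<comment> \<open>Stated for every \<open>y\<close>, since this function is differentiated below.
    The shifted \<open>d\<close> now stands before the shifted \<open>c\<close>, so the upper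
    parameters come out in reverse order and symmetry of the series restores it.\<close>
  have W3: "weight y (a + 1) (b + 1) (d + 1) (c + 2)
      = ?K3 * (y powr a * ((1 - y) powr \<gamma> * hyp2F1 (\<alpha> + 1) \<beta> (\<gamma> + 1) (1 - y)))" for y
  proof -
    have e: "d + 1 + (c + 2) - (a + 1) - (b + 1) = \<gamma> + 1" "d + 1 - (b + 1) = \<beta>"
       "c + 2 - (b + 1) = \<alpha> + 1"
      by (simp_all add: \<alpha>_def \<beta>_def \<gamma>_def)
    show ?thesis unfolding weight_def Let_def e Gam[OF pos(1)] Gam[OF pos(2)] Gam[OF pos(3)]
        Gam[OF pos(4)] Gam[OF gt(2)] hyp2F1_commute[of \<beta>]
      by (simp add: K_def mult_ac)
  qed
  have W4: "weight y (a + 1) (b + 2) (d + 2) (c + 2)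
      = ?K4 * (y powr a * ((1 - y) powr \<gamma> * hyp2F1 \<alpha> \<beta> (\<gamma> + 1) (1 - y)))" for y
  proof -
    have e: "d + 2 + (c + 2) - (a + 1) - (b + 2) = \<gamma> + 1" "d + 2 - (b + 2) = \<beta>"
       "c + 2 - (b + 2) = \<alpha>"
      by (simp_all add: \<alpha>_def \<beta>_def \<gamma>_def)
    show ?thesis unfolding weight_def Let_def e Gam[OF pos(1)] Gam[OF pos(2)] Gam[OF pos(3)]
        Gam[OF pos(4)] Gam[OF gt(2)] hyp2F1_commute[of \<beta>]
      by (simp add: K_def mult_ac)
  qed
  \<comment> \<open>The factor \<open>1 - x\<close> set free here is the \<open>z\<close> that
    multiplies \<open>G\<close> and \<open>H\<close> in the contiguity relations.\<close>
  have powr: "x powr a * (1 - x) powr \<gamma> = x * (1 - x) * P"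
    using x by (simp add: P_def powr_diff)
  have W3': "weight x (a + 1) (b + 1) (d + 1) (c + 2) = ?K3 * (x * (1 - x) * P * G)"
    unfolding W3 G_def powr[symmetric] by simp
  have W4': "weight x (a + 1) (b + 2) (d + 2) (c + 2) = ?K4 * (x * (1 - x) * P * H)"
    unfolding W4 H_def powr[symmetric] by simp
  have "F - F' = \<alpha> / \<gamma> * ((1 - x) * G)"
    unfolding F_def F'_def G_def by (rule hyp2F1_diff_upper_param[OF \<gamma> z])
  hence G: "(1 - x) * G = \<gamma> * (F - F') / \<alpha>" using gt by simp
  have "F' - x * F = \<epsilon> / \<gamma> * ((1 - x) * H)"
    using hyp2F1_raise_lower_param[OF \<gamma> z, of \<alpha> \<beta>]
    unfolding F_def F'_def H_def \<epsilon> by simp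
  hence H: "(1 - x) * H = \<gamma> * (F' - x * F) / \<epsilon>" using gt by simp
  have eqE: "\<gamma> * x * E = \<gamma> * F' + (\<alpha> + \<beta> - \<gamma>) * ((1 - x) * G)"
    using hyp2F1_lower_both_upper_params[OF \<gamma> z, of \<alpha> \<beta>]
    unfolding F'_def E_def G_def by simp
  have W3'': "weight x (a + 1) (b + 1) (d + 1) (c + 2) = ?K3 * (x * P * (\<gamma> * (F - F') / \<alpha>))"
    unfolding W3' G[symmetric] by simp
  have W4'': "weight x (a + 1) (b + 2) (d + 2) (c + 2)
      = ?K4 * (x * P * (\<gamma> * (F' - x * F) / \<epsilon>))"
    unfolding W4' H[symmetric] by simp
  have nz: "a \<noteq> 0" "b \<noteq> 0" "b + 1 \<noteq> 0" "\<gamma> \<noteq> 0" "\<alpha> \<noteq> 0" "\<epsilon> \<noteq> 0" using pos gt by auto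
  note distribs = right_diff_distrib left_diff_distrib diff_divide_distrib mult_ac power2_eq_square
  show ?A unfolding W1 W2 W3'' sub using nz by (simp add: distribs)
  show ?B unfolding W1 W2 W4'' sub using nz by (simp add: distribs)
  \<comment> \<open>The bracket from differentiating the first kernel. Since
    \<open>\<alpha> + \<beta> - \<gamma> = a - b\<close>, eliminating \<open>E\<close> changes the
    coefficient \<open>a\<close> into \<open>b\<close>; expressing \<open>G\<close> through
    \<open>F\<close> and \<open>F'\<close> then gives \<open>b + \<alpha> = c\<close>.\<close>
  have kerG: "a * ((1 - x) * G) - \<gamma> * x * E = \<gamma> / \<alpha> * (b * F - c * F')"
  proof -
    have "a * ((1 - x) * G) - \<gamma> * x * E = b * ((1 - x) * G) - \<gamma> * F'"
      unfolding eqE by (simp add: \<alpha>_def \<beta>_def \<gamma>_def algebra_simps)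
    also have "\<dots> = \<gamma> / \<alpha> * (b * F - (b + \<alpha>) * F')"
      unfolding G using nz by (simp add: field_simps)
    finally show ?thesis by (simp add: \<alpha>_def)
  qed
  have "((\<lambda>x. weight x (a + 1) (b + 1) (d + 1) (c + 2)) has_real_derivative
      ?K3 * (P * (\<gamma> / \<alpha> * (b * F - c * F')))) (at x)"
    unfolding W3 kerG[symmetric] unfolding G_def E_def P_def
    by (rule DERIV_cmult[OF has_real_derivative_weight_kernel[OF \<gamma> x]])
  also have "?K3 * (P * (\<gamma> / \<alpha> * (b * F - c * F'))) =
      c * (c + 1) * d / (a * (c - b)) * weight x a b c d
      - c * (c + 1) * d / (a * (c - b)) * weight x a (b + 1) (c + 1) d"
    unfolding W1 W2 sub using nz by (simp add: distribs)
  finally show ?C .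
  \<comment> \<open>For the second kernel the lowered series is \<open>F\<close> itself; only
    \<open>H\<close> is replaced, and \<open>a + \<epsilon> = d\<close>.\<close>
  have kerH: "a * ((1 - x) * H) - \<gamma> * x * F = \<gamma> / \<epsilon> * (a * F' - d * x * F)"
  proof -
    have "a * ((1 - x) * H) - \<gamma> * x * F
        = \<gamma> / \<epsilon> * (a * F' - (a + \<epsilon>) * x * F)"
      unfolding H using nz by (simp add: field_simps)
    thus ?thesis by (simp add: \<epsilon>_def)
  qed
  have "((\<lambda>x. weight x (a + 1) (b + 2) (d + 2) (c + 2)) has_real_derivative
      ?K4 * (P * (\<gamma> / \<epsilon> * (a * F' - d * x * F)))) (at x)"
    unfolding W4 kerH[symmetric] unfolding H_def F_def P_def
    by (rule DERIV_cmult[OF has_real_derivative_weight_kernel[OF \<gamma> x]])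
  also have "?K4 * (P * (\<gamma> / \<epsilon> * (a * F' - d * x * F))) =
      (c + 1) * d * (d + 1) / ((b + 1) * (d - a)) * weight x a (b + 1) (c + 1) d
      - c * (c + 1) * d\<^sup>2 * (d + 1) / (a * b * (b + 1) * (d - a)) * x * weight x a b c d"
    unfolding W1 W2 sub using nz by (simp add: distribs)
  finally show ?D .
qed

theorem theorem2p3:
  fixes a b c d :: real
  assumes "a > 0" and "b > 0" and "c > 0" and "d > 0"
    and "min c d > max a b"
  shows "\<forall>x\<in>{0<..<1}.
      x *\<^sub>R (Phi a b c d x *v weight_vec x a b c d)
        = weight_vec x (a + 1) (b + 1) (d + 1) (c + 2)
    \<and> (\<lambda>t. t *\<^sub>R (Phi a b c d t *v weight_vec t a b c d)) differentiable (at x)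
    \<and> vector_derivative (\<lambda>t. t *\<^sub>R (Phi a b c d t *v weight_vec t a b c d)) (at x)
        + Psi a b c d x *v weight_vec x a b c d = 0"
proof
  fix x :: real assume x: "x \<in> {0<..<1}"
  have cd: "c > a" "c > b" "d > a" "d > b" using assms(5) by auto
  note W = weight_system[OF assms(1-4) cd]
  let ?V = "\<lambda>t. t *\<^sub>R (Phi a b c d t *v weight_vec t a b c d)"
  let ?U = "\<lambda>t. weight_vec t (a + 1) (b + 1) (d + 1) (c + 2)"
  have U: "?U t = vector [weight t (a + 1) (b + 1) (d + 1) (c + 2),
      weight t (a + 1) (b + 2) (d + 2) (c + 2)]" for t
    by (simp add: weight_vec_def add.assoc)
  have VU: "?V t = ?U t" if "t \<in> {0<..<1}" for t
  proof -
    have t: "0 < t" "t < 1" using that by auto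
    show ?thesis
      unfolding U W(1,2)[OF t, symmetric]
      by (simp add: vec_eq_iff forall_2 Phi_def weight_vec_def matrix_vector_mult_def sum_2
          algebra_simps)
  qed
  have x': "0 < x" "x < 1" using x by auto
  have "(?U has_vector_derivative - (Psi a b c d x *v weight_vec x a b c d)) (at x)"
    unfolding U
    by (rule has_vector_derivative_eq_rhs[OF has_vector_derivative_vector_2[OF W(3,4)[OF x']]])
       (simp add: vec_eq_iff forall_2 Psi_def weight_vec_def matrix_vector_mult_def sum_2
          algebra_simps)
  \<comment> \<open>\<open>?V\<close> and \<open>?U\<close> agree on the open unit interval, a
    neighbourhood of \<open>x\<close>, so the derivative carries over from \<open>?U\<close> to
    \<open>?V\<close>.\<close>
  hence V: "(?V has_vector_derivative - (Psi a b c d x *v weight_vec x a b c d)) (at x)"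
    by (rule has_vector_derivative_transform_within_open[where S = "{0<..<1}"]) (use x VU in auto)
  show "?V x = ?U x \<and> ?V differentiable (at x)
      \<and> vector_derivative ?V (at x) + Psi a b c d x *v weight_vec x a b c d = 0"
    using VU[OF x] V differentiableI_vector[OF V] by (simp add: vector_derivative_at)
qed

end
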